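(* Let $(S,\mathcal{S},\hat{\mathcal{S}})$ be a localized Borel space. There exists a one-to-one, both ways measurable, correspondence between purely atomic measures $\mu\in\mathcal{M}_S$ and counting measures $N_\mu$ on $S\times(0,\infty)$ of the form $N_\mu(A\times B)=\sum_i\delta_{(s_i,\kappa_i)}(A\times B)$, where the $s_i$ are the (distinct) atoms of $\mu$ with respective values $\kappa_i=\mu(\{s_i\})$, satisfying $$\int_{A\times(0,\infty)}x\,N_\mu(ds\times dx)<\infty\quad\text{for every }A\in\hat{\mathcal{S}}.$$ The correspondence is the following: for every $A\in\hat{\mathcal{S}}$ and every $B\in\mathcal{B}((0,\infty))$ such that $0\notin\bar B$, $$\mu(A)=\int_{A\times(0,\infty)}x\,N_\mu(ds\times dx)$$ and $$N_\mu(A\times B)=\lim_{\varepsilon\to0}\lim_{n\to\infty}\sum_j\delta_{\mu(A_{nj})}(B_\varepsilon)\quad\text{for }B\text{ open},$$ $$N_\mu(A\times B)=\lim_{\varepsilon\to0}\lim_{n\to\infty}\sum_j\delta_{\mu(A_{nj})}(B^\varepsilon)\quad\text{for }B\text{ closed},$$ where $(A_{nj})$ is a dissection system of measurable subsets of $A$.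
   Context: A localized Borel space $(S,\mathcal{S},\hat{\mathcal{S}})$ consists of a Borel space $(S,\mathcal{S})$ and a localizing ring $\hat{\mathcal{S}}$, i.e. a ring $\hat{\mathcal{S}}\subset\mathcal{S}$ such that $B\cap C\in\hat{\mathcal{S}}$ for all $B\in\hat{\mathcal{S}}$, $C\in\mathcal{S}$, and $\hat{\mathcal{S}}=\bigcup_n(\mathcal{S}\cap S_n)$ for some sets $S_n\uparrow S$ in $\hat{\mathcal{S}}$. $\mathcal{M}_S$ is the space of measures on $(S,\mathcal{S})$ that are finite on $\hat{\mathcal{S}}$, with the $\sigma$-algebra generated by the maps $\mu\mapsto\mu(B)$, $B\in\mathcal{S}$; spaces of counting measures on $S\times(0,\infty)$ carry likewise the $\sigma$-algebra generated by evaluation on measurable sets. A measure $\mu$ is purely atomic if $\mu=\sum_i\kappa_i\delta_{s_i}$ for countably many distinct points $s_i\in S$ and $\kappa_i>0$. A dissection system $(A_{nj})$ of $A\in\hat{\mathcal{S}}$ is a sequence, indexed by $n\in\mathbb{N}$, of finite measurable partitions $\{A_{nj}\}_j$ of $A$, nested (each partition refines the previous one) and separating points (any two distinct points of $A$ lie in different $A_{nj}$'s for all large $n$). For an interval $B$ with extremes $a<b$ and $0<\varepsilon<\frac{b-a}{2}$, $B_\varepsilon=(a+\varepsilon,b-\varepsilon)$ and $B^\varepsilon=(a-\varepsilon,b+\varepsilon)$; similarly for a general set $B$, $B_\varepsilon=\{x:\mathrm{dist}(x,\mathbb{R}\setminus B)>\varepsilon\}$ and $B^\varepsilon=\{x:\mathrm{dist}(x,B)<\varepsilon\}$.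 The inner limits in $n$ need only exist for all sufficiently small $\varepsilon>0$. $\delta_y(C)=1$ if $y\in C$ and $0$ otherwise. *)

theory Defs
  imports "HOL-Analysis.Analysis"
begin

text \<open>
  Throughout, a measurable space \<open>(S, \<S>)\<close> is given by a value \<open>S\<close> of type \<open>'a measure\<close>
  of which only \<open>space S\<close> and \<open>sets S\<close> are used. The type \<open>'a\<close> is arbitrary.
\<close>

text \<open>Borel space: Borel isomorphic to a Borel subset of the real line.\<close>

definition borel_space :: "'a measure \<Rightarrow> bool" where
  "borel_space S \<longleftrightarrow>
    (\<exists>(E :: real set) f g. E \<in> sets borel \<and>
       f \<in> S \<rightarrow>\<^sub>M restrict_space borel E \<and> g \<in> restrict_space borel E \<rightarrow>\<^sub>M S \<and>
       (\<forall>s\<in>space S. g (f s) = s) \<and> (\<forall>x\<in>E. f (g x) = x))"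

definition localizing_ring :: "'a measure \<Rightarrow> 'a set set \<Rightarrow> bool" where
  "localizing_ring S R \<longleftrightarrow>
    ring_of_sets (space S) R \<and> R \<subseteq> sets S \<and>
    (\<forall>B\<in>R. \<forall>C\<in>sets S. B \<inter> C \<in> R) \<and>
    (\<exists>T :: nat \<Rightarrow> 'a set. range T \<subseteq> R \<and> incseq T \<and> (\<Union>n. T n) = space S \<and>
       R = (\<Union>n. {B \<inter> T n |B. B \<in> sets S}))"

definition localized_borel_space :: "'a measure \<Rightarrow> 'a set set \<Rightarrow> bool" where
  "localized_borel_space S R \<longleftrightarrow> borel_space S \<and> localizing_ring S R"

text \<open>The \<open>\<sigma>\<close>-algebra on a set \<open>X\<close> of measures on \<open>M\<close> generated by the evaluation maps.\<close>

definition evaluation_algebra :: "'b measure \<Rightarrow> 'b measure set \<Rightarrow> 'b measure measure" where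
  "evaluation_algebra M X = (SUP B\<in>sets M. vimage_algebra X (\<lambda>\<mu>. emeasure \<mu> B) borel)"

definition locally_finite_measures :: "'a measure \<Rightarrow> 'a set set \<Rightarrow> 'a measure set" where
  "locally_finite_measures S R = {\<mu>. sets \<mu> = sets S \<and> (\<forall>A\<in>R. emeasure \<mu> A < \<infinity>)}"

definition purely_atomic :: "'a measure \<Rightarrow> bool" where
  "purely_atomic \<mu> \<longleftrightarrow>
    (\<exists>(I :: nat set) s (\<kappa> :: nat \<Rightarrow> real).
       inj_on s I \<and> s ` I \<subseteq> space \<mu> \<and> (\<forall>i\<in>I. \<kappa> i > 0) \<and>
       (\<forall>A\<in>sets \<mu>. emeasure \<mu> A = (\<Sum>\<^sub>\<infinity>i\<in>I. ennreal (\<kappa> i) * indicator A (s i))))"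

definition purely_atomic_measures :: "'a measure \<Rightarrow> 'a set set \<Rightarrow> 'a measure set" where
  "purely_atomic_measures S R = {\<mu> \<in> locally_finite_measures S R. purely_atomic \<mu>}"

definition purely_atomic_algebra :: "'a measure \<Rightarrow> 'a set set \<Rightarrow> 'a measure measure" where
  "purely_atomic_algebra S R =
    restrict_space (evaluation_algebra S (locally_finite_measures S R)) (purely_atomic_measures S R)"

definition atoms :: "'a measure \<Rightarrow> 'a set" where
  "atoms \<mu> = {s \<in> space \<mu>. emeasure \<mu> {s} > 0}"

abbreviation pos_borel :: "real measure" where
  "pos_borel \<equiv> restrict_space borel {0<..}"

text \<open>
  The counting measures \<open>\<Sum>i. \<delta>\<^bsub>(s i, \<kappa> i)\<^esub>\<close> on \<open>S \<times> (0, \<infinity>)\<close> with countably many summands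
  and distinct \<open>s i\<close>, integrating the second coordinate over \<open>A \<times> (0, \<infinity>)\<close> for \<open>A \<in> R\<close>.
\<close>

definition atom_counting_measures :: "'a measure \<Rightarrow> 'a set set \<Rightarrow> ('a \<times> real) measure set" where
  "atom_counting_measures S R =
    {N. sets N = sets (S \<Otimes>\<^sub>M pos_borel) \<and>
        (\<exists>(I :: nat set) s \<kappa>. inj_on s I \<and> s ` I \<subseteq> space S \<and> (\<forall>i\<in>I. \<kappa> i > 0) \<and>
           (\<forall>C\<in>sets N. emeasure N C = (\<Sum>\<^sub>\<infinity>i\<in>I. indicator C (s i, \<kappa> i)))) \<and>
        (\<forall>A\<in>R. (\<integral>\<^sup>+p\<in>A \<times> {0<..}. ennreal (snd p) \<partial>N) < \<infinity>)}"

definition atom_counting_algebra :: "'a measure \<Rightarrow> 'a set set \<Rightarrow> ('a \<times> real) measure measure" where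
  "atom_counting_algebra S R =
    evaluation_algebra (S \<Otimes>\<^sub>M pos_borel) (atom_counting_measures S R)"

text \<open>The \<open>n\<close>-th partition consists of the sets \<open>D n j\<close> for \<open>j \<in> J n\<close>; some may be empty.\<close>

definition dissection_system ::
    "'a measure \<Rightarrow> 'a set \<Rightarrow> (nat \<Rightarrow> nat set) \<Rightarrow> (nat \<Rightarrow> nat \<Rightarrow> 'a set) \<Rightarrow> bool" where
  "dissection_system S A J D \<longleftrightarrow>
    (\<forall>n. finite (J n) \<and> (\<forall>j\<in>J n. D n j \<in> sets S) \<and>
         disjoint_family_on (D n) (J n) \<and> (\<Union>j\<in>J n. D n j) = A) \<and>
    (\<forall>n. \<forall>j\<in>J (Suc n). \<exists>i\<in>J n. D (Suc n) j \<subseteq> D n i) \<and>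
    (\<forall>s\<in>A. \<forall>t\<in>A. s \<noteq> t \<longrightarrow>
       (\<forall>\<^sub>F n in sequentially. \<forall>j\<in>J n. \<not> (s \<in> D n j \<and> t \<in> D n j)))"

text \<open>
  \<open>B\<^sub>\<epsilon>\<close> and \<open>B\<^sup>\<epsilon>\<close>. The distance to the empty set is \<open>\<infinity>\<close>, whereas \<open>infdist x {} = 0\<close>;
  hence the separate treatment of the empty set.
\<close>

definition inner_nbhd :: "real set \<Rightarrow> real \<Rightarrow> real set" where
  "inner_nbhd B \<epsilon> = {x. - B = {} \<or> infdist x (- B) > \<epsilon>}"

definition outer_nbhd :: "real set \<Rightarrow> real \<Rightarrow> real set" where
  "outer_nbhd B \<epsilon> = {x. B \<noteq> {} \<and> infdist x B < \<epsilon>}"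

text \<open>
  \<open>lim\<^bsub>\<epsilon>\<rightarrow>0\<^esub> lim\<^bsub>n\<rightarrow>\<infinity>\<^esub> f \<epsilon> n = l\<close>, where \<open>\<epsilon> > 0\<close> and the inner limits need only exist for
  all sufficiently small \<open>\<epsilon>\<close>.
\<close>

definition iterated_limit :: "(real \<Rightarrow> nat \<Rightarrow> ennreal) \<Rightarrow> ennreal \<Rightarrow> bool" where
  "iterated_limit f l \<longleftrightarrow>
    (\<exists>L. (\<forall>\<^sub>F \<epsilon> in at_right 0. f \<epsilon> \<longlonglongrightarrow> L \<epsilon>) \<and> (L \<longlongrightarrow> l) (at_right 0))"

end

theory Submission
  imports Defs
begin

text \<open>
  The correspondence sends \<open>\<mu>\<close> to the image of the counting measure on its atoms under
  \<open>s \<mapsto> (s, \<mu>{s})\<close>; integrating the second coordinate recovers \<open>\<mu>\<close>, which gives bijectivity and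
  measurability of the inverse. For a dissection system of \<open>A\<close>, all but an arbitrarily small mass
  of \<open>A\<close> sits in finitely many atoms, which end up in different cells. The mass of the cell around
  an atom then decreases to the mass of that atom, while the masses of the remaining cells become
  uniformly small; so for small \<open>\<epsilon>\<close> the number of cells with mass in \<open>B\<^sub>\<epsilon>\<close> (or \<open>B\<^sup>\<epsilon>\<close>) is
  eventually equal to the number of atoms with mass in \<open>B\<close>. For \<open>B = [c, \<infinity>)\<close> no \<open>\<epsilon>\<close> is needed,
  as cell masses approach atomic masses from above. Hence \<open>\<mu> \<mapsto> N\<^sub>\<mu>(A \<times> [c, \<infinity>))\<close> is measurable,
  and a Dynkin argument on boxes of finite \<open>N\<^sub>\<mu>\<close>-measure extends this to all measurable sets.
\<close>

section \<open>Countable sums and \<sigma>-algebras generated by evaluations\<close>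

text \<open>The definitions speak of unordered sums, while integrals over \<open>count_space\<close>
  come with change of variables. On \<open>nat\<close> both sides are the same series, as every
  family in \<open>ennreal\<close> is summable; an enumeration carries this over to
  \<open>A\<close>.\<close>

lemma infsum_ennreal_eq_nn_integral:
  fixes f :: "'a \<Rightarrow> ennreal"
  assumes "countable A"
  shows "(\<Sum>\<^sub>\<infinity>x\<in>A. f x) = (\<integral>\<^sup>+x. f x \<partial>count_space A)"
proof -
  have nat: "(\<Sum>\<^sub>\<infinity>n\<in>I. g n) = (\<integral>\<^sup>+n. g n \<partial>count_space I)" for I :: "nat set" and g :: "nat \<Rightarrow> ennreal"
  proof -
    let ?h = "\<lambda>n. g n * indicator I n"
    have "(\<Sum>\<^sub>\<infinity>n\<in>I. g n) = (\<Sum>\<^sub>\<infinity>n\<in>UNIV. ?h n)"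
      by (rule infsum_cong_neutral) auto
    also have "\<dots> = (\<Sum>n. ?h n)"
    proof -
      have "(?h has_sum (\<Sum>\<^sub>\<infinity>n\<in>UNIV. ?h n)) UNIV"
        by (intro has_sum_infsum nonneg_summable_on_complete) simp
      then show ?thesis
        using has_sum_imp_sums sums_unique by blast
    qed
    also have "\<dots> = (\<integral>\<^sup>+n. g n \<partial>count_space I)"
      by (subst nn_integral_count_space_nat[symmetric])
         (auto simp: nn_integral_count_space_indicator intro!: nn_integral_cong split: split_indicator)
    finally show ?thesis .
  qed
  let ?e = "to_nat_on A" and ?d = "from_nat_into A"
  have bij: "bij_betw ?e A (?e ` A)"
    using assms by (simp add: bij_betw_def inj_on_to_nat_on)
  have "(\<Sum>\<^sub>\<infinity>x\<in>A. f x) = (\<Sum>\<^sub>\<infinity>x\<in>A. f (?d (?e x)))"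
    using assms by (intro infsum_cong) simp
  also have "\<dots> = (\<Sum>\<^sub>\<infinity>n\<in>?e ` A. f (?d n))"
    by (rule infsum_reindex_bij_betw[OF bij])
  also have "\<dots> = (\<integral>\<^sup>+x. f (?d (?e x)) \<partial>count_space A)"
    unfolding nat by (rule nn_integral_bij_count_space[OF bij, symmetric])
  also have "\<dots> = (\<integral>\<^sup>+x. f x \<partial>count_space A)"
    using assms by (intro nn_integral_cong) simp
  finally show ?thesis .
qed

lemma space_evaluation_algebra [simp]: "space (evaluation_algebra M X) = X"
  using sets.empty_sets[of M] by (auto simp: evaluation_algebra_def space_Sup_eq_UN)

lemma measurable_emeasure_evaluation_algebra:
  "B \<in> sets M \<Longrightarrow> (\<lambda>\<mu>. emeasure \<mu> B) \<in> borel_measurable (evaluation_algebra M X)"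
  unfolding evaluation_algebra_def
  by (rule measurable_SUP1) (auto intro: measurable_vimage_algebra1)

lemma measurable_evaluation_algebraI:
  assumes "\<And>x. x \<in> space K \<Longrightarrow> f x \<in> X"
    and "\<And>B. B \<in> sets M \<Longrightarrow> (\<lambda>x. emeasure (f x) B) \<in> borel_measurable K"
  shows "f \<in> K \<rightarrow>\<^sub>M evaluation_algebra M X"
  unfolding evaluation_algebra_def
proof (rule measurable_SUP2)
  show "sets M \<noteq> {}" by auto
qed (use assms in \<open>auto intro!: measurable_vimage_algebra2\<close>)

text \<open>Evaluations at sets are measurable by construction, and building \<open>f\<close> from
  indicators by linear operations and increasing limits preserves this. It serves the inverse of the
  correspondence, which is given by an integral.\<close>

lemma measurable_nn_integral_evaluation_algebra:
  assumes f: "f \<in> borel_measurable M" and X: "\<And>\<mu>. \<mu> \<in> X \<Longrightarrow> sets \<mu> = sets M"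
  shows "(\<lambda>\<mu>. integral\<^sup>N \<mu> f) \<in> borel_measurable (evaluation_algebra M X)"
  using f
proof induction
  case (cong f g)
  moreover have "(\<lambda>\<mu>. integral\<^sup>N \<mu> f) \<in> borel_measurable (evaluation_algebra M X) \<longleftrightarrow>
      (\<lambda>\<mu>. integral\<^sup>N \<mu> g) \<in> borel_measurable (evaluation_algebra M X)"
    using cong X by (intro measurable_cong nn_integral_cong) (auto dest: sets_eq_imp_space_eq)
  ultimately show ?case by simp
next
  case (set B)
  moreover have "(\<lambda>\<mu>. \<integral>\<^sup>+x. indicator B x \<partial>\<mu>) \<in> borel_measurable (evaluation_algebra M X) \<longleftrightarrow>
      (\<lambda>\<mu>. emeasure \<mu> B) \<in> borel_measurable (evaluation_algebra M X)"
    using set X by (intro measurable_cong) simp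
  ultimately show ?case
    by (simp add: measurable_emeasure_evaluation_algebra)
next
  case (mult u c)
  moreover have "(\<lambda>\<mu>. \<integral>\<^sup>+x. c * u x \<partial>\<mu>) \<in> borel_measurable (evaluation_algebra M X) \<longleftrightarrow>
      (\<lambda>\<mu>. c * integral\<^sup>N \<mu> u) \<in> borel_measurable (evaluation_algebra M X)"
    using mult X by (intro measurable_cong nn_integral_cmult) (auto cong: measurable_cong_sets)
  ultimately show ?case by simp
next
  case (add u v)
  moreover have "(\<lambda>\<mu>. \<integral>\<^sup>+x. v x + u x \<partial>\<mu>) \<in> borel_measurable (evaluation_algebra M X) \<longleftrightarrow>
      (\<lambda>\<mu>. integral\<^sup>N \<mu> v + integral\<^sup>N \<mu> u) \<in> borel_measurable (evaluation_algebra M X)"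
    using add X by (intro measurable_cong nn_integral_add) (auto cong: measurable_cong_sets)
  ultimately show ?case by simp
next
  case (seq U)
  have *: "(\<lambda>\<mu>. integral\<^sup>N \<mu> (SUP i. U i)) \<in> borel_measurable (evaluation_algebra M X) \<longleftrightarrow>
      (\<lambda>\<mu>. SUP i. integral\<^sup>N \<mu> (U i)) \<in> borel_measurable (evaluation_algebra M X)"
  proof (rule measurable_cong)
    fix \<mu> assume "\<mu> \<in> space (evaluation_algebra M X)"
    then have "U i \<in> borel_measurable \<mu>" for i
      using seq X by (auto cong: measurable_cong_sets)
    moreover have "(SUP i. U i) = (\<lambda>x. SUP i. U i x)"
      by (simp add: fun_eq_iff image_comp)
    ultimately show "integral\<^sup>N \<mu> (SUP i. U i) = (SUP i. integral\<^sup>N \<mu> (U i))"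
      using seq nn_integral_monotone_convergence_SUP[of U \<mu>] by simp
  qed
  have "(\<lambda>\<mu>. SUP i. integral\<^sup>N \<mu> (U i)) \<in> borel_measurable (evaluation_algebra M X)"
    using seq by simp
  then show ?case
    unfolding * .
qed

section \<open>Generators of the product with the positive half-line\<close>

text \<open>Half-lines closed on the left are chosen because the masses of cells decrease to the
  masses of atoms: boxes \<open>A \<times> {c..}\<close> are the sets for which measurability is
  obtained directly.\<close>

lemma sets_prod_pos_borel:
  "sets (S \<Otimes>\<^sub>M pos_borel) = sigma_sets (space S \<times> {0<..})
     {A \<times> ({x..} \<inter> {0<..}) |A x. A \<in> sets S}"
proof -
  let ?G = "range (\<lambda>x::real. {x..} \<inter> {0<..})"
  have eq: "sets pos_borel = sigma_sets {0<..} ?G"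
  proof -
    have "sets (borel :: real measure) = sigma_sets UNIV (range (\<lambda>x. {x..}))"
      by (subst borel_Ici) simp
    moreover have "{0::real<..} \<in> sets borel" by simp
    ultimately have "(\<inter>) {0<..} ` sets (borel :: real measure) =
        sigma_sets {0<..} ((\<inter>) {0<..} ` range (\<lambda>x. {x..}))"
      using restricted_sigma[of "{0::real<..}" UNIV "range (\<lambda>x. {x..})"] by simp
    moreover have "(\<inter>) {0<..} ` range (\<lambda>x::real. {x..}) = ?G" by auto
    ultimately show ?thesis
      by (simp add: sets_restrict_space)
  qed
  have "sets (S \<Otimes>\<^sub>M pos_borel) = sets (sigma (space S \<times> space pos_borel) {a \<times> b |a b. a \<in> sets S \<and> b \<in> ?G})"
  proof (rule sets_pair_eq)
    show "sets S \<subseteq> Pow (space S)" by (rule sets.space_closed)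
    show "sets S = sigma_sets (space S) (sets S)" by (simp add: sets.sigma_sets_eq)
    show "sets pos_borel = sigma_sets (space pos_borel) ?G"
      using eq by (simp add: space_restrict_space)
    show "{space S} \<subseteq> sets S" by simp
    \<comment> \<open>The half-line with \<open>x = 0\<close> is all of \<open>{0<..}\<close>, so a
      single generator covers the second factor.\<close>
    show "{{0<..}} \<subseteq> ?G" by (auto intro!: image_eqI[of _ _ 0])
  qed (auto simp: space_restrict_space)
  also have "{a \<times> b |a b. a \<in> sets S \<and> b \<in> ?G} = {A \<times> ({x..} \<inter> {0<..}) |A x. A \<in> sets S}"
    by blast
  also have "sets (sigma (space S \<times> space pos_borel) \<dots>) = sigma_sets (space S \<times> {0<..}) \<dots>"
    by (subst sets_measure_of) (use sets.sets_into_space in \<open>auto simp: space_restrict_space\<close>)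
  finally show ?thesis .
qed

lemma space_prod_pos_borel: "space (S \<Otimes>\<^sub>M pos_borel) = space S \<times> {0<..}"
  by (simp add: space_pair_measure space_restrict_space)

lemma measurable_indicator_times_snd:
  assumes "A \<in> sets S"
  shows "(\<lambda>p. ennreal (snd p) * indicator (A \<times> {0<..}) p) \<in> borel_measurable (S \<Otimes>\<^sub>M pos_borel)"
proof -
  have [measurable]: "snd \<in> borel_measurable (S \<Otimes>\<^sub>M pos_borel)"
    by (rule measurable_compose[OF measurable_snd]) (simp add: measurable_restrict_space1)
  have "{0<..} \<in> sets pos_borel"
    by (simp add: sets_restrict_space_iff)
  then have [measurable]: "A \<times> {0<..} \<in> sets (S \<Otimes>\<^sub>M pos_borel)"
    using assms by (rule pair_measureI[rotated])
  show ?thesis by measurable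
qed

lemma atLeast_sets_pos_borel:
  fixes c :: real
  assumes "c > 0"
  shows "{c..} \<in> sets pos_borel"
  using assms by (auto simp: sets_restrict_space_iff)

text \<open>This becomes the \<open>N \<mu>\<close> of the theorem. Being a pushforward of the
  counting measure on the atoms, it needs no enumeration, and integrals against it turn into sums
  over \<open>atoms \<mu>\<close>.\<close>

definition atom_marking :: "'a measure \<Rightarrow> 'a measure \<Rightarrow> ('a \<times> real) measure" where
  "atom_marking S \<mu> =
    distr (count_space (atoms \<mu>)) (S \<Otimes>\<^sub>M pos_borel) (\<lambda>s. (s, measure \<mu> {s}))"

lemma sets_atom_marking [simp]: "sets (atom_marking S \<mu>) = sets (S \<Otimes>\<^sub>M pos_borel)"
  by (simp add: atom_marking_def)

section \<open>Points and bounded sets of a localized Borel space\<close>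

locale localized_space =
  fixes S :: "'a measure" and R :: "'a set set"
  assumes localized: "localized_borel_space S R"
begin

text \<open>The isomorphism with a Borel subset of the line exhibits \<open>{s}\<close> as the
  preimage of a point.\<close>

lemma singleton_sets:
  assumes "s \<in> space S"
  shows "{s} \<in> sets S"
proof -
  obtain E :: "real set" and f g where f: "f \<in> S \<rightarrow>\<^sub>M restrict_space borel E"
    and inv: "\<forall>s\<in>space S. g (f s) = s"
    using localized unfolding localized_borel_space_def borel_space_def by blast
  have "f \<in> borel_measurable S"
    using f by (simp add: measurable_restrict_space2_iff)
  then have "f -` {f s} \<inter> space S \<in> sets S"
    by (rule measurable_sets) simp
  also have "f -` {f s} \<inter> space S = {s}"
    using inv assms by auto (metis inv)
  finally show ?thesis .
qed

lemma localizing: "localizing_ring S R"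
  using localized by (simp add: localized_borel_space_def)

lemma exhaustion:
  obtains T :: "nat \<Rightarrow> 'a set" where "range T \<subseteq> R" "incseq T" "(\<Union>n. T n) = space S"
  using localizing unfolding localizing_ring_def by (elim conjE exE) (rule that)

lemma ring_sets: "A \<in> R \<Longrightarrow> A \<in> sets S"
  using localizing unfolding localizing_ring_def by (elim conjE) (rule subsetD)

lemma ring_Int: "A \<in> R \<Longrightarrow> B \<in> sets S \<Longrightarrow> A \<inter> B \<in> R"
  using localizing unfolding localizing_ring_def by (elim conjE) (drule (1) bspec, drule (1) bspec)

lemma ring_subset: "A \<in> R \<Longrightarrow> B \<in> sets S \<Longrightarrow> B \<subseteq> A \<Longrightarrow> B \<in> R"
  using ring_Int[of A B] by (simp add: Int_absorb1)

text \<open>This makes the mass of a point finite under every locally finite measure, so that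
  passing from \<open>emeasure\<close> to \<open>measure\<close> loses nothing there.\<close>

lemma singleton_ring:
  assumes "s \<in> space S"
  shows "{s} \<in> R"
proof -
  obtain T :: "nat \<Rightarrow> 'a set" where "range T \<subseteq> R" "(\<Union>n. T n) = space S"
    by (rule exhaustion)
  with assms obtain n where "s \<in> T n" "T n \<in> R" by blast
  then show ?thesis
    using ring_subset singleton_sets[OF assms] by blast
qed

text \<open>Injectivity of \<open>s\<close> leaves a single term in the sum for
  \<open>{s i}\<close>. Hence points and weights of any such representation are determined by the
  measure.\<close>

lemma atoms_of_weighted_sum:
  assumes I: "inj_on s I" "s ` I \<subseteq> space S" "\<And>i. i \<in> I \<Longrightarrow> \<kappa> i > 0"
    and \<mu>: "sets \<mu> = sets S"
      "\<And>A. A \<in> sets S \<Longrightarrow> emeasure \<mu> A = (\<integral>\<^sup>+i. ennreal (\<kappa> i) * indicator A (s i) \<partial>count_space I)"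
  shows "atoms \<mu> = s ` I" and "\<And>i. i \<in> I \<Longrightarrow> measure \<mu> {s i} = \<kappa> i"
proof -
  have eq: "emeasure \<mu> {s i} = ennreal (\<kappa> i)" if "i \<in> I" for i
  proof -
    have "emeasure \<mu> {s i} = (\<integral>\<^sup>+k. ennreal (\<kappa> k) * indicator {s i} (s k) \<partial>count_space I)"
      using I that by (intro \<mu>(2) singleton_sets) auto
    also have "\<dots> = (\<Sum>k\<in>{i}. ennreal (\<kappa> k) * indicator {s i} (s k))"
      using I that by (intro nn_integral_count_space') (auto simp: inj_on_def indicator_def)
    finally show ?thesis by simp
  qed
  have "emeasure \<mu> {x} = 0" if "x \<in> space S" "x \<notin> s ` I" for x
  proof -
    have "emeasure \<mu> {x} = (\<integral>\<^sup>+k. ennreal (\<kappa> k) * indicator {x} (s k) \<partial>count_space I)"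
      using that by (intro \<mu>(2) singleton_sets)
    also have "\<dots> = (\<integral>\<^sup>+k. 0 \<partial>count_space I)"
      using that by (intro nn_integral_cong) (auto simp: indicator_def)
    finally show ?thesis by simp
  qed
  then show "atoms \<mu> = s ` I"
    using I eq sets_eq_imp_space_eq[OF \<mu>(1)] by (fastforce simp: atoms_def)
  show "measure \<mu> {s i} = \<kappa> i" if "i \<in> I" for i
    using eq[OF that] I(3)[OF that] by (simp add: measure_def)
qed

section \<open>Purely atomic measures and the marking of their atoms\<close>

context
  fixes \<mu> :: "'a measure"
  assumes \<mu>: "\<mu> \<in> purely_atomic_measures S R"
begin

lemma sets_purely_atomic: "sets \<mu> = sets S"
  using \<mu> by (simp add: purely_atomic_measures_def locally_finite_measures_def)

lemma space_purely_atomic: "space \<mu> = space S"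
  using sets_purely_atomic by (rule sets_eq_imp_space_eq)

lemma fmeasurable_purely_atomic: "A \<in> R \<Longrightarrow> A \<in> fmeasurable \<mu>"
  using \<mu> ring_sets
  by (simp add: fmeasurable_def purely_atomic_measures_def locally_finite_measures_def)

text \<open>Reindexing along \<open>s\<close> replaces the arbitrary representation in
  \<open>purely_atomic\<close> by the canonical one over the atoms, since
  \<open>atoms_of_weighted_sum\<close> identifies points and weights.\<close>

lemma
  shows countable_atoms: "countable (atoms \<mu>)"
    and emeasure_purely_atomic: "A \<in> sets S \<Longrightarrow>
      emeasure \<mu> A = (\<integral>\<^sup>+s. ennreal (measure \<mu> {s}) * indicator A s \<partial>count_space (atoms \<mu>))"
proof -
  obtain I :: "nat set" and s and \<kappa> :: "nat \<Rightarrow> real" where I: "inj_on s I" "s ` I \<subseteq> space \<mu>"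
    "\<forall>i\<in>I. \<kappa> i > 0"
    "\<forall>A\<in>sets \<mu>. emeasure \<mu> A = (\<Sum>\<^sub>\<infinity>i\<in>I. ennreal (\<kappa> i) * indicator A (s i))"
    using \<mu> unfolding purely_atomic_measures_def purely_atomic_def by blast
  have rep: "emeasure \<mu> A = (\<integral>\<^sup>+i. ennreal (\<kappa> i) * indicator A (s i) \<partial>count_space I)"
    if "A \<in> sets S" for A
    using I(4) that sets_purely_atomic by (simp add: infsum_ennreal_eq_nn_integral)
  have atoms: "atoms \<mu> = s ` I" "\<And>i. i \<in> I \<Longrightarrow> measure \<mu> {s i} = \<kappa> i"
    using atoms_of_weighted_sum[of s I \<kappa> \<mu>] I rep sets_purely_atomic space_purely_atomic by auto
  then show "countable (atoms \<mu>)" by simp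
  have bij: "bij_betw s I (atoms \<mu>)"
    using I atoms by (simp add: bij_betw_def)
  show "emeasure \<mu> A = (\<integral>\<^sup>+s. ennreal (measure \<mu> {s}) * indicator A s \<partial>count_space (atoms \<mu>))"
    if "A \<in> sets S"
    unfolding rep[OF that] nn_integral_bij_count_space[OF bij, symmetric]
    by (intro nn_integral_cong) (simp add: atoms)
qed

lemma atoms_in_space: "atoms \<mu> \<subseteq> space S"
  by (auto simp: atoms_def space_purely_atomic)

lemma subset_atoms_sets:
  assumes "B \<subseteq> atoms \<mu>"
  shows "B \<in> sets S"
proof (rule sets.countable)
  show "countable B"
    using assms countable_atoms by (rule countable_subset)
qed (use assms atoms_in_space singleton_sets in blast)

text \<open>\<open>measure\<close> takes the value 0 where \<open>emeasure\<close> is infinite;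
  \<open>singleton_ring\<close> rules this out.\<close>

lemma measure_atom_pos: "s \<in> atoms \<mu> \<Longrightarrow> measure \<mu> {s} > 0"
  using fmeasurable_purely_atomic[OF singleton_ring, of s]
  by (auto simp: atoms_def space_purely_atomic fmeasurable_def measure_def enn2real_positive_iff)

lemma measurable_marking:
  "(\<lambda>s. (s, measure \<mu> {s})) \<in> count_space (atoms \<mu>) \<rightarrow>\<^sub>M S \<Otimes>\<^sub>M pos_borel"
  using atoms_in_space measure_atom_pos
  by (auto simp: space_pair_measure space_restrict_space)

lemma nn_integral_atom_marking:
  "f \<in> borel_measurable (S \<Otimes>\<^sub>M pos_borel) \<Longrightarrow>
    integral\<^sup>N (atom_marking S \<mu>) f = (\<integral>\<^sup>+s. f (s, measure \<mu> {s}) \<partial>count_space (atoms \<mu>))"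
  unfolding atom_marking_def by (intro nn_integral_distr measurable_marking) simp

lemma emeasure_atom_marking:
  "C \<in> sets (S \<Otimes>\<^sub>M pos_borel) \<Longrightarrow>
    emeasure (atom_marking S \<mu>) C = (\<integral>\<^sup>+s. indicator C (s, measure \<mu> {s}) \<partial>count_space (atoms \<mu>))"
  by (subst nn_integral_atom_marking[symmetric]) auto

text \<open>Weighting each marked atom by its mark gives back its mass. As \<open>A\<close> may have
  infinite mass here, the marking determines \<open>\<mu>\<close> on all of
  \<open>sets S\<close>.\<close>

lemma emeasure_eq_integral_atom_marking:
  assumes "A \<in> sets S"
  shows "emeasure \<mu> A = (\<integral>\<^sup>+p\<in>A \<times> {0<..}. ennreal (snd p) \<partial>atom_marking S \<mu>)"
proof -
  show ?thesis
    unfolding emeasure_purely_atomic[OF assms]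
    by (subst nn_integral_atom_marking[OF measurable_indicator_times_snd[OF assms]])
       (auto intro!: nn_integral_cong simp: measure_atom_pos split: split_indicator)
qed

lemma atom_marking_counting: "atom_marking S \<mu> \<in> atom_counting_measures S R"
  unfolding atom_counting_measures_def
proof (intro CollectI conjI ballI)
  \<comment> \<open>The indices have to be natural numbers; the image of the atoms under
    \<open>to_nat_on\<close> serves for finitely and infinitely many atoms alike.\<close>
  let ?e = "to_nat_on (atoms \<mu>)" and ?d = "from_nat_into (atoms \<mu>)"
  let ?I = "?e ` atoms \<mu>"
  have bij: "bij_betw ?e (atoms \<mu>) ?I"
    using countable_atoms by (simp add: bij_betw_def inj_on_to_nat_on)
  have "inj_on ?d ?I"
    using countable_atoms by (auto simp: inj_on_def)
  moreover have "?d ` ?I \<subseteq> space S"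
    using countable_atoms atoms_in_space by auto
  moreover have "\<forall>i\<in>?I. measure \<mu> {?d i} > 0"
    using countable_atoms measure_atom_pos by auto
  moreover have "emeasure (atom_marking S \<mu>) C = (\<Sum>\<^sub>\<infinity>i\<in>?I. indicator C (?d i, measure \<mu> {?d i}))"
    if "C \<in> sets (atom_marking S \<mu>)" for C
    unfolding infsum_reindex_bij_betw[OF bij, symmetric] using that countable_atoms
    by (simp add: emeasure_atom_marking infsum_ennreal_eq_nn_integral cong: nn_integral_cong_simp)
  ultimately show "\<exists>(I :: nat set) s \<kappa>. inj_on s I \<and> s ` I \<subseteq> space S \<and> (\<forall>i\<in>I. \<kappa> i > 0) \<and>
      (\<forall>C\<in>sets (atom_marking S \<mu>). emeasure (atom_marking S \<mu>) C = (\<Sum>\<^sub>\<infinity>i\<in>I. indicator C (s i, \<kappa> i)))"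
    by (intro exI[of _ ?I] exI[of _ ?d] exI[of _ "\<lambda>i. measure \<mu> {?d i}"]) blast
next
  fix A assume "A \<in> R"
  then show "(\<integral>\<^sup>+p\<in>A \<times> {0<..}. ennreal (snd p) \<partial>atom_marking S \<mu>) < \<infinity>"
    using fmeasurable_purely_atomic[of A] ring_sets
    by (simp add: emeasure_eq_integral_atom_marking[symmetric] fmeasurable_def)
qed simp

end

section \<open>Bijectivity of the marking\<close>

text \<open>Injectivity: \<open>\<mu>\<close> is recovered from its marking by integration.
  Surjectivity: the measure with mass \<open>\<kappa> i\<close> at \<open>s i\<close> is locally
  finite by the integrability condition on \<open>N\<close>, its atoms are the \<open>s i\<close>,
  and so its marking is \<open>N\<close>.\<close>

lemma bij_betw_atom_marking:
  "bij_betw (atom_marking S) (purely_atomic_measures S R) (atom_counting_measures S R)"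
  unfolding bij_betw_def
proof (intro conjI)
  show "inj_on (atom_marking S) (purely_atomic_measures S R)"
  proof (rule inj_onI)
    fix \<mu> \<nu> assume *: "\<mu> \<in> purely_atomic_measures S R" "\<nu> \<in> purely_atomic_measures S R"
      "atom_marking S \<mu> = atom_marking S \<nu>"
    then show "\<mu> = \<nu>"
      by (intro measure_eqI) (simp_all add: sets_purely_atomic emeasure_eq_integral_atom_marking)
  qed
  have "N \<in> atom_marking S ` purely_atomic_measures S R" if N: "N \<in> atom_counting_measures S R" for N
  proof -
    have sets: "sets N = sets (S \<Otimes>\<^sub>M pos_borel)"
      and fin: "\<And>A. A \<in> R \<Longrightarrow> (\<integral>\<^sup>+p\<in>A \<times> {0<..}. ennreal (snd p) \<partial>N) < \<infinity>"
      using N by (simp_all add: atom_counting_measures_def)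
    have "\<exists>(I :: nat set) s \<kappa>. inj_on s I \<and> s ` I \<subseteq> space S \<and> (\<forall>i\<in>I. \<kappa> i > 0) \<and>
        (\<forall>C\<in>sets N. emeasure N C = (\<Sum>\<^sub>\<infinity>i\<in>I. indicator C (s i, \<kappa> i)))"
      using N unfolding atom_counting_measures_def by (elim CollectE conjE)
    then obtain I :: "nat set" and s and \<kappa> :: "nat \<Rightarrow> real" where
      I: "inj_on s I" "s ` I \<subseteq> space S" "\<And>i. i \<in> I \<Longrightarrow> \<kappa> i > 0"
      and sum: "\<And>C. C \<in> sets N \<Longrightarrow> emeasure N C = (\<Sum>\<^sub>\<infinity>i\<in>I. indicator C (s i, \<kappa> i))"
      by metis
    have N_emeasure: "emeasure N C = (\<integral>\<^sup>+i. indicator C (s i, \<kappa> i) \<partial>count_space I)" if "C \<in> sets N" for C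
      using sum[OF that] by (simp add: infsum_ennreal_eq_nn_integral)
    have meas: "(\<lambda>i. (s i, \<kappa> i)) \<in> count_space I \<rightarrow>\<^sub>M S \<Otimes>\<^sub>M pos_borel"
      using I by (auto simp: space_pair_measure space_restrict_space)
    \<comment> \<open>The values of \<open>N\<close> on sets are known; as a pushforward,
      \<open>N\<close> can also be integrated by change of variables.\<close>
    have N_eq: "N = distr (count_space I) (S \<Otimes>\<^sub>M pos_borel) (\<lambda>i. (s i, \<kappa> i))"
    proof (rule measure_eqI)
      fix C assume C: "C \<in> sets N"
      then show "emeasure N C = emeasure (distr (count_space I) (S \<Otimes>\<^sub>M pos_borel) (\<lambda>i. (s i, \<kappa> i))) C"
        unfolding N_emeasure[OF C] using sets meas
        by (subst nn_integral_indicator[symmetric], simp) (subst nn_integral_distr, auto)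
    qed (simp add: sets)
    \<comment> \<open>The weights enter as a density on the index set, which is then transported
      along \<open>s\<close>.\<close>
    define \<mu> where "\<mu> = distr (density (count_space I) (\<lambda>i. ennreal (\<kappa> i))) S s"
    have \<mu>_sets: "sets \<mu> = sets S" by (simp add: \<mu>_def)
    have \<mu>_emeasure: "emeasure \<mu> A = (\<integral>\<^sup>+i. ennreal (\<kappa> i) * indicator A (s i) \<partial>count_space I)"
      if "A \<in> sets S" for A
    proof -
      have "s \<in> density (count_space I) (\<lambda>i. ennreal (\<kappa> i)) \<rightarrow>\<^sub>M S"
        using I(2) by auto
      then have "emeasure \<mu> A = (\<integral>\<^sup>+i. indicator A (s i) \<partial>density (count_space I) (\<lambda>i. ennreal (\<kappa> i)))"
        unfolding \<mu>_def using that
        by (subst nn_integral_indicator[symmetric], simp) (subst nn_integral_distr, auto)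
      also have "\<dots> = (\<integral>\<^sup>+i. ennreal (\<kappa> i) * indicator A (s i) \<partial>count_space I)"
        by (subst nn_integral_density) auto
      finally show ?thesis .
    qed
    note atoms = atoms_of_weighted_sum[OF I \<mu>_sets \<mu>_emeasure]
    have "emeasure \<mu> A < \<infinity>" if "A \<in> R" for A
    proof -
      have "(\<integral>\<^sup>+p\<in>A \<times> {0<..}. ennreal (snd p) \<partial>N) = emeasure \<mu> A"
        unfolding \<mu>_emeasure[OF ring_sets[OF that]] N_eq
        by (subst nn_integral_distr[OF meas]) (auto simp: measurable_indicator_times_snd[OF ring_sets[OF that]] intro!: nn_integral_cong simp: I split: split_indicator)
      with fin[OF that] show ?thesis by simp
    qed
    moreover have "purely_atomic \<mu>"
      unfolding purely_atomic_def using I \<mu>_emeasure \<mu>_sets sets_eq_imp_space_eq[OF \<mu>_sets]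
      by (intro exI[of _ I] exI[of _ s] exI[of _ \<kappa>]) (auto simp: infsum_ennreal_eq_nn_integral)
    ultimately have \<mu>: "\<mu> \<in> purely_atomic_measures S R"
      using \<mu>_sets by (simp add: purely_atomic_measures_def locally_finite_measures_def)
    have bij: "bij_betw s I (atoms \<mu>)"
      using I atoms by (simp add: bij_betw_def)
    have "atom_marking S \<mu> = N"
    proof (rule measure_eqI)
      fix C assume "C \<in> sets (atom_marking S \<mu>)"
      then show "emeasure (atom_marking S \<mu>) C = emeasure N C"
        by (simp add: emeasure_atom_marking[OF \<mu>] N_emeasure sets nn_integral_bij_count_space[OF bij, symmetric]
            atoms cong: nn_integral_cong_simp)
    qed (simp add: sets)
    with \<mu> show ?thesis by blast
  qed
  then show "atom_marking S ` purely_atomic_measures S R = atom_counting_measures S R"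
    using atom_marking_counting by blast
qed

end

section \<open>Counting the cells of a dissection system\<close>

lemma dissection_systemD:
  assumes "dissection_system S A J D"
  shows "finite (J n)" "\<And>j. j \<in> J n \<Longrightarrow> D n j \<in> sets S"
    "disjoint_family_on (D n) (J n)" "(\<Union>j\<in>J n. D n j) = A"
    "\<And>s t. s \<in> A \<Longrightarrow> t \<in> A \<Longrightarrow> s \<noteq> t \<Longrightarrow>
      \<forall>\<^sub>F n in sequentially. \<forall>j\<in>J n. \<not> (s \<in> D n j \<and> t \<in> D n j)"
  using assms by (simp_all add: dissection_system_def)

text \<open>The cell counts do more than converge: for small \<open>\<epsilon>\<close> they
  eventually equal the limit, so a constant function serves as the inner limit.\<close>

lemma iterated_limit_eventually:
  assumes "\<forall>\<^sub>F \<epsilon> in at_right 0. \<forall>\<^sub>F n in sequentially. f \<epsilon> n = l"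
  shows "iterated_limit f l"
  unfolding iterated_limit_def
proof (intro exI[of _ "\<lambda>_. l"] conjI tendsto_const)
  show "\<forall>\<^sub>F \<epsilon> in at_right 0. f \<epsilon> \<longlonglongrightarrow> l"
    using assms by eventually_elim (rule tendsto_eventually)
qed

context localized_space
begin

context
  fixes \<mu> :: "'a measure" and A :: "'a set"
  assumes \<mu>: "\<mu> \<in> purely_atomic_measures S R" and A: "A \<in> R"
begin

text \<open>Any \<open>k\<close> such atoms give \<open>k * d \<le> measure \<mu> A\<close>, where
  \<open>A\<close> has finite mass; this bounds the size of all finite subsets.\<close>

lemma finite_large_atoms:
  assumes "d > 0"
  shows "finite {s \<in> atoms \<mu> \<inter> A. measure \<mu> {s} \<ge> d}" (is "finite ?K")
proof (rule finite_if_finite_subsets_card_bdd[THEN conjunct1])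
  fix G assume G: "G \<subseteq> ?K" "finite G"
  have sing: "{s} \<in> sets \<mu>" if "s \<in> G" for s
    using G that atoms_in_space[OF \<mu>] singleton_sets sets_purely_atomic[OF \<mu>] by auto
  have GA: "G \<in> sets \<mu>"
    using sets.finite_UN[of G "\<lambda>s. {s}" \<mu>] sing G by simp
  have "of_nat (card G) * d \<le> (\<Sum>s\<in>G. measure \<mu> {s})"
    using G by (intro sum_bounded_below) auto
  also have "\<dots> = measure \<mu> G"
  proof (rule measure_eq_sum_singleton[symmetric])
    show "emeasure \<mu> {s} \<noteq> \<infinity>" if "s \<in> G" for s
      using fmeasurable_purely_atomic[OF \<mu> singleton_ring, of s] G that atoms_in_space[OF \<mu>]
      by (auto simp: fmeasurable_def)
  qed (use G sing in auto)
  also have "\<dots> \<le> measure \<mu> A"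
    using G GA by (intro measure_mono_fmeasurable fmeasurable_purely_atomic[OF \<mu> A]) auto
  finally have "real (card G) \<le> measure \<mu> A / d"
    using assms by (simp add: field_simps)
  then show "card G \<le> nat \<lceil>measure \<mu> A / d\<rceil>"
    by linarith
qed

text \<open>Removing ever more atoms leaves sets that decrease to \<open>A\<close> without its
  atoms, a null set because \<open>\<mu>\<close> is purely atomic. Continuity from above applies
  since \<open>A\<close> has finite mass.\<close>

lemma finite_atoms_almost_exhaust:
  assumes "r > 0"
  obtains F where "finite F" "F \<subseteq> atoms \<mu> \<inter> A" "measure \<mu> (A - F) < r"
proof -
  let ?X = "atoms \<mu> \<inter> A"
  have X: "countable ?X" using countable_atoms[OF \<mu>] by simp
  define F where "F n = {x \<in> ?X. to_nat_on ?X x < n}" for n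
  have fin: "finite (F n)" for n
  proof (rule inj_on_finite)
    show "inj_on (to_nat_on ?X) (F n)"
      by (rule inj_on_subset[OF inj_on_to_nat_on[OF X]]) (auto simp: F_def)
    show "to_nat_on ?X ` F n \<subseteq> {..<n}" by (auto simp: F_def)
  qed simp
  have A_sets: "A \<in> sets \<mu>"
    using ring_sets[OF A] sets_purely_atomic[OF \<mu>] by simp
  have F_sets: "A - F n \<in> sets \<mu>" for n
    using A_sets subset_atoms_sets[OF \<mu>, of "F n"] sets_purely_atomic[OF \<mu>]
    by (intro sets.Diff) (auto simp: F_def)
  have "(\<lambda>n. emeasure \<mu> (A - F n)) \<longlonglongrightarrow> emeasure \<mu> (\<Inter>n. A - F n)"
  proof (rule Lim_emeasure_decseq)
    show "decseq (\<lambda>n. A - F n)" by (auto simp: decseq_def F_def)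
    show "emeasure \<mu> (A - F n) \<noteq> \<infinity>" for n
      using fmeasurable_purely_atomic[OF \<mu> ring_subset[OF A, of "A - F n"]] F_sets sets_purely_atomic[OF \<mu>]
      by (auto simp: fmeasurable_def)
  qed (use F_sets in auto)
  also have "(\<Inter>n. A - F n) = A - ?X"
    by (auto simp: F_def)
  also have "emeasure \<mu> (A - ?X) = (\<integral>\<^sup>+s. 0 \<partial>count_space (atoms \<mu>))"
    using A_sets subset_atoms_sets[OF \<mu>, of ?X] sets_purely_atomic[OF \<mu>]
    by (subst emeasure_purely_atomic[OF \<mu>]) (simp, intro nn_integral_cong, simp)
  finally have "(\<lambda>n. emeasure \<mu> (A - F n)) \<longlonglongrightarrow> 0" by simp
  then have "\<forall>\<^sub>F n in sequentially. emeasure \<mu> (A - F n) < ennreal r"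
    by (rule order_tendstoD) (use assms in \<open>simp only: ennreal_less_zero_iff\<close>)
  then obtain n where "emeasure \<mu> (A - F n) < ennreal r"
    by (auto simp: eventually_sequentially)
  moreover have "emeasure \<mu> (A - F n) = ennreal (measure \<mu> (A - F n))"
    using fmeasurable_purely_atomic[OF \<mu> ring_subset[OF A, of "A - F n"]] F_sets sets_purely_atomic[OF \<mu>]
    by (intro emeasure_eq_measure2) auto
  ultimately have "measure \<mu> (A - F n) < r"
    using assms by (simp add: ennreal_less_iff)
  then show ?thesis
    using fin[of n] by (intro that[of "F n"]) (auto simp: F_def)
qed

text \<open>Since \<open>B\<close> stays away from 0, only finitely many atoms in \<open>A\<close>
  have mass in \<open>B\<close>, and the sum of indicators is a cardinality.\<close>

lemma emeasure_atom_marking_eq_card: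
  assumes B: "B \<in> sets pos_borel" "B \<subseteq> {c..}" and "c > 0"
  shows "finite {s \<in> atoms \<mu> \<inter> A. measure \<mu> {s} \<in> B}"
    and "emeasure (atom_marking S \<mu>) (A \<times> B) = of_nat (card {s \<in> atoms \<mu> \<inter> A. measure \<mu> {s} \<in> B})"
proof -
  let ?K = "{s \<in> atoms \<mu> \<inter> A. measure \<mu> {s} \<in> B}"
  show fin: "finite ?K"
    by (rule finite_subset[OF _ finite_large_atoms[OF \<open>c > 0\<close>]]) (use B in auto)
  have "emeasure (atom_marking S \<mu>) (A \<times> B) =
      (\<integral>\<^sup>+s. indicator (A \<times> B) (s, measure \<mu> {s}) \<partial>count_space (atoms \<mu>))"
    using ring_sets[OF A] B(1) by (intro emeasure_atom_marking[OF \<mu>] pair_measureI)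
  also have "\<dots> = (\<Sum>s\<in>?K. indicator (A \<times> B) (s, measure \<mu> {s}))"
    using fin by (intro nn_integral_count_space') (auto simp: indicator_def)
  also have "\<dots> = (\<Sum>s\<in>?K. 1)"
    by (intro sum.cong) auto
  finally show "emeasure (atom_marking S \<mu>) (A \<times> B) = of_nat (card ?K)" by simp
qed

text \<open>
  The mass of the cell around an atom \<open>s\<close> decreases to the mass of \<open>s\<close>, hence only the behaviour
  of \<open>C\<close> immediately to the right of the atomic masses matters. The bound \<open>c\<close> makes all but
  finitely many atoms irrelevant.
\<close>

lemma eventually_count_cells:
  assumes D: "dissection_system S A J D"
    and B: "B \<in> sets pos_borel" "B \<subseteq> {c..}" and C: "C \<subseteq> {c..}" and c: "c > 0"
    and near: "\<And>s. s \<in> atoms \<mu> \<inter> A \<Longrightarrow> measure \<mu> {s} \<ge> c / 2 \<Longrightarrow>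
      \<exists>r>0. \<forall>x. measure \<mu> {s} \<le> x \<and> x < measure \<mu> {s} + r \<longrightarrow> (x \<in> C \<longleftrightarrow> measure \<mu> {s} \<in> B)"
  shows "\<forall>\<^sub>F n in sequentially.
    (\<Sum>j\<in>J n. indicator C (measure \<mu> (D n j))) = emeasure (atom_marking S \<mu>) (A \<times> B)"
proof -
  let ?m = "\<lambda>s. measure \<mu> {s}"
  \<comment> \<open>The threshold \<open>c / 2\<close> catches every atom whose cell may have mass
    in \<open>C\<close>: such a cell has mass at least \<open>c\<close>, and all of it but less than
    \<open>c / 2\<close> will come from one atom.\<close>
  define K where "K = {s \<in> atoms \<mu> \<inter> A. ?m s \<ge> c / 2}"
  have K: "finite K" unfolding K_def using c by (intro finite_large_atoms) simp
  obtain \<rho> where \<rho>: "\<And>s. s \<in> K \<Longrightarrow> \<rho> s > 0"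
    "\<And>s x. s \<in> K \<Longrightarrow> ?m s \<le> x \<Longrightarrow> x < ?m s + \<rho> s \<Longrightarrow> x \<in> C \<longleftrightarrow> ?m s \<in> B"
  proof -
    have "\<forall>s\<in>K. \<exists>r>0. \<forall>x. ?m s \<le> x \<and> x < ?m s + r \<longrightarrow> (x \<in> C \<longleftrightarrow> ?m s \<in> B)"
      using near by (auto simp: K_def)
    then show ?thesis using that by metis
  qed
  \<comment> \<open>One radius for all of \<open>K\<close>. The entry \<open>c / 2\<close> keeps the
    minimum defined for empty \<open>K\<close> and keeps cells that meet no selected atom below mass
    \<open>c\<close>.\<close>
  define r where "r = Min (insert (c / 2) (\<rho> ` K))"
  have r: "r > 0" "r \<le> c / 2" "\<And>s. s \<in> K \<Longrightarrow> r \<le> \<rho> s"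
    unfolding r_def using K c \<rho>(1) by (simp, intro Min_le, simp_all)
  obtain F0 where F0: "finite F0" "F0 \<subseteq> atoms \<mu> \<inter> A" "measure \<mu> (A - F0) < r"
    using finite_atoms_almost_exhaust[OF r(1)] by blast
  \<comment> \<open>Adding \<open>K\<close> ensures that its atoms get separated too, and only
    lowers the mass outside.\<close>
  define F where "F = F0 \<union> K"
  have F: "finite F" "F \<subseteq> atoms \<mu> \<inter> A" "K \<subseteq> F"
    using F0 K by (auto simp: F_def K_def)
  note D_sets = dissection_systemD(2)[OF D]
  have fm: "B \<in> fmeasurable \<mu>" if "B \<in> sets S" "B \<subseteq> A" for B
    using fmeasurable_purely_atomic[OF \<mu> ring_subset[OF A that]] .
  have F_sets: "F \<in> sets S" and F0_sets: "F0 \<in> sets S"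
    using F F0 by (auto intro!: subset_atoms_sets[OF \<mu>])
  have small: "measure \<mu> (A - F) < r"
  proof -
    have "measure \<mu> (A - F) \<le> measure \<mu> (A - F0)"
      using F_sets F0_sets ring_sets[OF A] sets_purely_atomic[OF \<mu>]
      by (intro measure_mono_fmeasurable fm) (auto simp: F_def)
    with F0 show ?thesis by simp
  qed
  \<comment> \<open>The system separates each pair of points eventually, hence finitely many pairs
    simultaneously.\<close>
  have "\<forall>\<^sub>F n in sequentially. \<forall>s\<in>F. \<forall>t\<in>F. s \<noteq> t \<longrightarrow> (\<forall>j\<in>J n. \<not> (s \<in> D n j \<and> t \<in> D n j))"
  proof (intro eventually_ball_finite F ballI)
    fix s t assume "s \<in> F" "t \<in> F"
    then show "\<forall>\<^sub>F n in sequentially. s \<noteq> t \<longrightarrow> (\<forall>j\<in>J n. \<not> (s \<in> D n j \<and> t \<in> D n j))"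
      using dissection_systemD(5)[OF D, of s t] F(2) by (cases "s = t") auto
  qed
  then show ?thesis
  proof eventually_elim
    case (elim n)
    have D_un: "(\<Union>j\<in>J n. D n j) = A"
      using D by (rule dissection_systemD)
    then have D_sub: "D n j \<subseteq> A" if "j \<in> J n" for j
      using that by blast
    have "\<forall>s\<in>A. \<exists>j. j \<in> J n \<and> s \<in> D n j"
      using D_un by blast
    then obtain cell where cell: "\<And>s. s \<in> A \<Longrightarrow> cell s \<in> J n \<and> s \<in> D n (cell s)"
      by metis
    have cell_eq: "cell s = j" if "j \<in> J n" "s \<in> D n j" for s j
    proof -
      have "s \<in> A" using that D_sub by blast
      then show ?thesis
        using cell[of s] that dissection_systemD(3)[OF D, of n] unfolding disjoint_family_on_def by blast
    qed
    \<comment> \<open>The cell of \<open>s\<close> contains no other point of \<open>F\<close>, so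
      it exceeds the atom \<open>s\<close> by less than \<open>r\<close>.\<close>
    have mass: "?m s \<le> measure \<mu> (D n j) \<and> measure \<mu> (D n j) < ?m s + r"
      if "j \<in> J n" "s \<in> F" "s \<in> D n j" for s j
    proof
      have s: "{s} \<in> sets S" "s \<in> A"
        using F that atoms_in_space[OF \<mu>] singleton_sets by auto
      show "?m s \<le> measure \<mu> (D n j)"
        using that s D_sets[OF that(1)] D_sub[OF that(1)] sets_purely_atomic[OF \<mu>]
        by (intro measure_mono_fmeasurable fm) auto
      have "D n j \<subseteq> {s} \<union> (A - F)"
        using elim that D_sub[OF that(1)] by blast
      moreover have "{s} \<union> (A - F) \<in> sets S"
        using s F_sets ring_sets[OF A] by (intro sets.Un sets.Diff)
      ultimately have "measure \<mu> (D n j) \<le> measure \<mu> ({s} \<union> (A - F))"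
        using s D_sets[OF that(1)] F_sets ring_sets[OF A] sets_purely_atomic[OF \<mu>]
        by (intro measure_mono_fmeasurable fm) auto
      also have "\<dots> \<le> ?m s + measure \<mu> (A - F)"
        using s F_sets ring_sets[OF A] sets_purely_atomic[OF \<mu>] by (intro measure_Un_le) auto
      finally show "measure \<mu> (D n j) < ?m s + r" using small by simp
    qed
    \<comment> \<open>Each atom is matched with its cell; as the cell mass lies within
      \<open>r\<close> to the right of the atomic mass, the one is in \<open>C\<close> exactly if
      the other is in \<open>B\<close>.\<close>
    have "bij_betw cell {s \<in> atoms \<mu> \<inter> A. ?m s \<in> B} {j \<in> J n. measure \<mu> (D n j) \<in> C}"
    proof (rule bij_betw_imageI)
      have BK: "{s \<in> atoms \<mu> \<inter> A. ?m s \<in> B} \<subseteq> K"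
        using B c by (force simp: K_def)
      show "inj_on cell {s \<in> atoms \<mu> \<inter> A. ?m s \<in> B}"
      proof (rule inj_onI)
        fix s t
        assume "s \<in> {s \<in> atoms \<mu> \<inter> A. ?m s \<in> B}" "t \<in> {s \<in> atoms \<mu> \<inter> A. ?m s \<in> B}"
          and eq: "cell s = cell t"
        then have "s \<in> F" "t \<in> F" "s \<in> A" "t \<in> A"
          using BK F by blast+
        then show "s = t"
          using elim cell[of s] cell[of t] eq by metis
      qed
      show "cell ` {s \<in> atoms \<mu> \<inter> A. ?m s \<in> B} = {j \<in> J n. measure \<mu> (D n j) \<in> C}"
      proof (intro equalityI subsetI)
        fix j assume "j \<in> cell ` {s \<in> atoms \<mu> \<inter> A. ?m s \<in> B}"
        then obtain s where s: "s \<in> K" "s \<in> A" "?m s \<in> B" "j = cell s"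
          using BK by blast
        then have j: "j \<in> J n" "s \<in> D n j" using cell by auto
        then show "j \<in> {j \<in> J n. measure \<mu> (D n j) \<in> C}"
          using mass[of j s] \<rho>(2)[of s "measure \<mu> (D n j)"] r(3)[of s] s F(3) by auto
      next
        fix j assume "j \<in> {j \<in> J n. measure \<mu> (D n j) \<in> C}"
        then have j: "j \<in> J n" "measure \<mu> (D n j) \<in> C" "measure \<mu> (D n j) \<ge> c"
          using C by auto
        \<comment> \<open>A cell missing \<open>F\<close> has mass below
          \<open>r \<le> c / 2\<close>. The atom found has mass above \<open>c - r\<close>, so it
          lies in \<open>K\<close>.\<close>
        have "\<exists>s\<in>F. s \<in> D n j"
        proof (rule ccontr)
          assume "\<not> ?thesis"
          then have "measure \<mu> (D n j) \<le> measure \<mu> (A - F)"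
            using D_sub[OF j(1)] D_sets[OF j(1)] F_sets ring_sets[OF A] sets_purely_atomic[OF \<mu>]
            by (intro measure_mono_fmeasurable fm) auto
          with small r(2) j(3) c show False by simp
        qed
        then obtain s where s: "s \<in> F" "s \<in> D n j" by blast
        note m = mass[OF j(1) s]
        have "s \<in> K"
          using m j(3) r(2) s F(2) by (auto simp: K_def)
        then have "?m s \<in> B"
          using \<rho>(2)[of s "measure \<mu> (D n j)"] m r(3)[of s] j(2) by auto
        then show "j \<in> cell ` {s \<in> atoms \<mu> \<inter> A. ?m s \<in> B}"
          using s F(2) cell_eq[OF j(1) s(2)] by blast
      qed
    qed
    then have "card {s \<in> atoms \<mu> \<inter> A. ?m s \<in> B} = card {j \<in> J n. measure \<mu> (D n j) \<in> C}"
      by (rule bij_betw_same_card)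
    moreover have "(\<Sum>j\<in>J n. indicator C (measure \<mu> (D n j)) :: ennreal) =
        of_nat (card {j \<in> J n. measure \<mu> (D n j) \<in> C})"
      using dissection_systemD(1)[OF D, of n] by (simp add: indicator_def sum.If_cases Int_def)
    ultimately show ?case
      using emeasure_atom_marking_eq_card(2)[OF B c] by simp
  qed
qed

text \<open>Take \<open>\<epsilon>\<close> below the distance to \<open>- B\<close> of each of the
  finitely many atomic masses in \<open>B\<close>. These masses then lie in the open set
  \<open>inner_nbhd B \<epsilon>\<close>, as do all points close to them.\<close>

lemma inner_limit_count_cells:
  assumes D: "dissection_system S A J D"
    and B: "B \<in> sets pos_borel" "B \<subseteq> {c..}" "c > 0" "open B"
  shows "iterated_limit (\<lambda>\<epsilon> n. \<Sum>j\<in>J n. indicator (inner_nbhd B \<epsilon>) (measure \<mu> (D n j)))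
    (emeasure (atom_marking S \<mu>) (A \<times> B))"
proof (rule iterated_limit_eventually)
  let ?m = "\<lambda>s. measure \<mu> {s}"
  have ne: "- B \<noteq> {}" using B(2) by (auto dest: subsetD[of _ _ "c - 1"])
  have "\<forall>\<^sub>F \<epsilon> in at_right 0. \<forall>s\<in>{s \<in> atoms \<mu> \<inter> A. ?m s \<in> B}. \<epsilon> < infdist (?m s) (- B)"
  proof (intro eventually_ball_finite emeasure_atom_marking_eq_card(1)[OF B(1-3)] ballI)
    fix s assume "s \<in> {s \<in> atoms \<mu> \<inter> A. ?m s \<in> B}"
    then have "infdist (?m s) (- B) > 0"
      using B(4) ne by (intro infdist_pos_not_in_closed) (auto simp: closed_Compl)
    then show "\<forall>\<^sub>F \<epsilon> in at_right 0. \<epsilon> < infdist (?m s) (- B)"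
      by (rule order_tendstoD(2)[OF tendsto_ident_at])
  qed
  then show "\<forall>\<^sub>F \<epsilon> in at_right 0. \<forall>\<^sub>F n in sequentially.
      (\<Sum>j\<in>J n. indicator (inner_nbhd B \<epsilon>) (measure \<mu> (D n j))) = emeasure (atom_marking S \<mu>) (A \<times> B)"
    using eventually_at_right_less[of 0]
  proof eventually_elim
    case (elim \<epsilon>)
    have sub: "inner_nbhd B \<epsilon> \<subseteq> B"
    proof
      fix x assume "x \<in> inner_nbhd B \<epsilon>"
      with elim(2) ne show "x \<in> B"
        using infdist_zero[of x "- B"] by (cases "x \<in> B") (auto simp: inner_nbhd_def)
    qed
    have op: "open (inner_nbhd B \<epsilon>)"
      unfolding inner_nbhd_def using ne by (simp add: open_Collect_less continuous_intros)
    show ?case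
    proof (rule eventually_count_cells[OF D B(1,2) _ B(3)])
      fix s assume s: "s \<in> atoms \<mu> \<inter> A"
      show "\<exists>r>0. \<forall>x. ?m s \<le> x \<and> x < ?m s + r \<longrightarrow> (x \<in> inner_nbhd B \<epsilon> \<longleftrightarrow> ?m s \<in> B)"
      proof (cases "?m s \<in> B")
        case True
        then have "?m s \<in> inner_nbhd B \<epsilon>"
          using elim(1) s by (auto simp: inner_nbhd_def)
        then obtain r where "r > 0" "ball (?m s) r \<subseteq> inner_nbhd B \<epsilon>"
          using op by (auto simp: open_contains_ball)
        with True show ?thesis
          by (intro exI[of _ r]) (auto simp: subset_iff dist_real_def)
      next
        case False
        \<comment> \<open>A point closer than \<open>\<epsilon>\<close> to a mass outside
          \<open>B\<close> is too close to \<open>- B\<close>, so the radius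
          \<open>\<epsilon>\<close> works.\<close>
        have "x \<notin> inner_nbhd B \<epsilon>" if "?m s \<le> x" "x < ?m s + \<epsilon>" for x
          using infdist_le[of "?m s" "- B" x] False that ne by (auto simp: inner_nbhd_def dist_real_def)
        with False elim(2) show ?thesis by blast
      qed
    qed (use sub B in auto)
  qed
qed

text \<open>Take \<open>\<epsilon>\<close> below the distance to \<open>B\<close> of each relevant
  atomic mass outside \<open>B\<close>; as \<open>B\<close> is closed these distances are positive,
  and finitely many masses matter.\<close>

lemma outer_limit_count_cells:
  assumes D: "dissection_system S A J D"
    and B: "B \<in> sets pos_borel" "B \<subseteq> {c..}" "c > 0" "closed B"
  shows "iterated_limit (\<lambda>\<epsilon> n. \<Sum>j\<in>J n. indicator (outer_nbhd B \<epsilon>) (measure \<mu> (D n j)))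
    (emeasure (atom_marking S \<mu>) (A \<times> B))"
proof (rule iterated_limit_eventually)
  let ?m = "\<lambda>s. measure \<mu> {s}"
  \<comment> \<open>The enlargement of \<open>B\<close> may reach down to \<open>c / 2\<close>, and
    \<open>eventually_count_cells\<close> halves its bound once more.\<close>
  have fin: "finite {s \<in> atoms \<mu> \<inter> A. ?m s \<ge> c / 4}"
    using B(3) by (intro finite_large_atoms) simp
  have "\<forall>\<^sub>F \<epsilon> in at_right 0. \<forall>s\<in>{s \<in> atoms \<mu> \<inter> A. ?m s \<ge> c / 4}.
      B \<noteq> {} \<longrightarrow> ?m s \<notin> B \<longrightarrow> \<epsilon> < infdist (?m s) B"
  proof (intro eventually_ball_finite fin ballI)
    fix s
    show "\<forall>\<^sub>F \<epsilon> in at_right 0. B \<noteq> {} \<longrightarrow> ?m s \<notin> B \<longrightarrow> \<epsilon> < infdist (?m s) B"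
    proof (cases "B \<noteq> {} \<and> ?m s \<notin> B")
      case True
      then have "infdist (?m s) B > 0"
        using B(4) by (intro infdist_pos_not_in_closed) auto
      then have "\<forall>\<^sub>F \<epsilon> in at_right 0. \<epsilon> < infdist (?m s) B"
        by (rule order_tendstoD(2)[OF tendsto_ident_at])
      then show ?thesis by eventually_elim simp
    qed auto
  qed
  moreover have "\<forall>\<^sub>F \<epsilon> in at_right 0. \<epsilon> < c / 2"
    using B(3) by (intro order_tendstoD(2)[OF tendsto_ident_at]) simp
  ultimately show "\<forall>\<^sub>F \<epsilon> in at_right 0. \<forall>\<^sub>F n in sequentially.
      (\<Sum>j\<in>J n. indicator (outer_nbhd B \<epsilon>) (measure \<mu> (D n j))) = emeasure (atom_marking S \<mu>) (A \<times> B)"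
    using eventually_at_right_less[of 0]
  proof eventually_elim
    case (elim \<epsilon>)
    have sub: "outer_nbhd B \<epsilon> \<subseteq> {c / 2..}"
    proof
      fix x assume x: "x \<in> outer_nbhd B \<epsilon>"
      then obtain b where "b \<in> B" "dist x b < \<epsilon>"
        using cInf_lessD[of "dist x ` B" \<epsilon>] infdist_notempty[of B x] by (auto simp: outer_nbhd_def)
      then show "x \<in> {c / 2..}" using B(2) elim(2) by (force simp: dist_real_def)
    qed
    show ?case
    proof (rule eventually_count_cells[OF D B(1) _ sub])
      fix s assume s: "s \<in> atoms \<mu> \<inter> A" "?m s \<ge> c / 2 / 2"
      show "\<exists>r>0. \<forall>x. ?m s \<le> x \<and> x < ?m s + r \<longrightarrow> (x \<in> outer_nbhd B \<epsilon> \<longleftrightarrow> ?m s \<in> B)"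
      proof (cases "?m s \<in> B")
        case True
        have "x \<in> outer_nbhd B \<epsilon>" if "?m s \<le> x" "x < ?m s + \<epsilon>" for x
          using infdist_le[of "?m s" B x] True that by (auto simp: outer_nbhd_def dist_real_def)
        with True elim(3) show ?thesis by blast
      next
        case False
        show ?thesis
        \<comment> \<open>For empty \<open>B\<close>, \<open>infdist\<close> is 0 and yields no
          radius, but then no point lies in \<open>outer_nbhd B \<epsilon>\<close>.\<close>
        proof (cases "B = {}")
          case True
          then show ?thesis by (auto simp: outer_nbhd_def intro: exI[of _ 1])
        next
          case ne: False
          \<comment> \<open>Moving by less than this keeps the distance to \<open>B\<close> above
            \<open>\<epsilon>\<close>, by the triangle inequality.\<close>
          let ?r = "infdist (?m s) B - \<epsilon>"
          have "?r > 0" using elim(1) s ne False by auto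
          moreover have "x \<notin> outer_nbhd B \<epsilon>" if "?m s \<le> x" "x < ?m s + ?r" for x
            using infdist_triangle[of "?m s" B x] that by (auto simp: outer_nbhd_def dist_real_def)
          ultimately show ?thesis using False by blast
        qed
      qed
    qed (use B in auto)
  qed
qed

end

section \<open>Existence of dissection systems\<close>

text \<open>Dyadic intervals are pulled back along an injective measurable map into the unit
  interval. Existence is needed for measurability, where the count is to be approximated by
  evaluations.\<close>

lemma dissection_system_exists:
  assumes A: "A \<in> sets S"
  obtains J D where "dissection_system S A J D"
proof -
  obtain E :: "real set" and f g where f: "f \<in> S \<rightarrow>\<^sub>M restrict_space borel E"
    and inv: "\<forall>s\<in>space S. g (f s) = s"
    using localized unfolding localized_borel_space_def borel_space_def by blast
  have f_meas [measurable]: "f \<in> borel_measurable S"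
    using f by (simp add: measurable_restrict_space2_iff)
  \<comment> \<open>\<open>arctan\<close>, rescaled, embeds the line into the open unit
    interval.\<close>
  define h where "h s = 1 / 2 + arctan (f s) / pi" for s
  have h_meas [measurable]: "h \<in> borel_measurable S"
    unfolding h_def by (intro borel_measurable_add borel_measurable_divide measurable_compose[OF f_meas]
        borel_measurable_continuous_onI continuous_intros) auto
  have h_bounds: "0 < h s" "h s < 1" for s
    using arctan_lbound[of "f s"] arctan_ubound[of "f s"] by (auto simp: h_def field_simps)
  have h_inj: "s = t" if "h s = h t" "s \<in> space S" "t \<in> space S" for s t
    using that inv by (auto simp: h_def arctan_eq_iff) (metis inv)
  \<comment> \<open>The number of the dyadic interval of length \<open>1 / 2 ^ n\<close> that
    contains \<open>h s\<close>.\<close>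
  define q where "q n s = nat \<lfloor>2 ^ n * h s\<rfloor>" for n s
  have q_less: "q n s < 2 ^ n" for n s
  proof -
    have "2 ^ n * h s < 2 ^ n * 1"
      using h_bounds by (intro mult_strict_left_mono) auto
    then have "\<lfloor>2 ^ n * h s\<rfloor> < 2 ^ n" by (simp add: floor_less_iff)
    then show ?thesis by (simp add: q_def nat_less_iff h_bounds less_imp_le)
  qed
  have q_bounds: "real (q n s) \<le> 2 ^ n * h s" "2 ^ n * h s < real (q n s) + 1" for n s
    using h_bounds[of s] by (auto simp: q_def less_imp_le)
  \<comment> \<open>Each dyadic interval consists of two intervals of the next level; this gives
    nestedness.\<close>
  have q_Suc: "q n s = q (Suc n) s div 2" for n s
  proof -
    have "real (q (Suc n) s) \<le> 2 * (2 ^ n * h s)" "2 * (2 ^ n * h s) < real (q (Suc n) s) + 1"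
      using q_bounds[of "Suc n" s] by (simp_all add: mult.assoc)
    moreover have "a = b div 2" if "real b \<le> 2 * y" "2 * y < real b + 1" "real a \<le> y" "y < real a + 1"
      for a b :: nat and y :: real
    proof -
      have "real b < real (2 * (a + 1))" "real (2 * a) < real (b + 1)"
        using that by simp_all
      then have "b < 2 * (a + 1)" "2 * a < b + 1"
        by (simp_all only: of_nat_less_iff)
      then show ?thesis by presburger
    qed
    ultimately show ?thesis
      using q_bounds[of n s] by blast
  qed
  define D where "D n j = {s \<in> A. q n s = j}" for n j
  have D_sets: "D n j \<in> sets S" for n j
  proof -
    have "{s \<in> space S. q n s = j} \<in> sets S"
      unfolding q_def by measurable
    then have "A \<inter> {s \<in> space S. q n s = j} \<in> sets S"
      using A by (rule sets.Int[rotated])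
    also have "A \<inter> {s \<in> space S. q n s = j} = D n j"
      using sets.sets_into_space[OF A] by (auto simp: D_def)
    finally show ?thesis .
  qed
  have "dissection_system S A (\<lambda>n. {..<2 ^ n}) D"
    unfolding dissection_system_def
  proof (intro conjI allI ballI impI)
    fix n j assume "j \<in> {..<2 ^ Suc n :: nat}"
    moreover have "D (Suc n) j \<subseteq> D n (j div 2)"
      by (auto simp: D_def q_Suc[of n])
    ultimately show "\<exists>i\<in>{..<2 ^ n}. D (Suc n) j \<subseteq> D n i"
      by (intro bexI[of _ "j div 2"]) auto
  next
    fix s t assume st: "s \<in> A" "t \<in> A" "s \<noteq> t"
    then have "\<bar>h s - h t\<bar> > 0"
      using h_inj[of s t] sets.sets_into_space[OF A] by auto
    moreover have "(\<lambda>n. (1 / 2) ^ n :: real) \<longlonglongrightarrow> 0"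
      by (rule LIMSEQ_power_zero) simp
    ultimately have "\<forall>\<^sub>F n in sequentially. (1 / 2) ^ n < \<bar>h s - h t\<bar>"
      by (intro order_tendstoD)
    then show "\<forall>\<^sub>F n in sequentially. \<forall>j\<in>{..<2 ^ n}. \<not> (s \<in> D n j \<and> t \<in> D n j)"
    proof eventually_elim
      case (elim n)
      \<comment> \<open>Points with the same number have values of \<open>h\<close> less than
        \<open>1 / 2 ^ n\<close> apart.\<close>
      have "q n s \<noteq> q n t"
      proof
        assume "q n s = q n t"
        then have "\<bar>2 ^ n * h s - 2 ^ n * h t\<bar> < 1"
          using q_bounds[of n s] q_bounds[of n t] by linarith
        moreover have "\<bar>2 ^ n * h s - 2 ^ n * h t\<bar> = 2 ^ n * \<bar>h s - h t\<bar>"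
          by (simp add: abs_mult flip: right_diff_distrib)
        ultimately show False
          using elim by (simp add: power_one_over field_simps)
      qed
      then show ?case by (auto simp: D_def)
    qed
  qed (use D_sets q_less in \<open>auto simp: D_def disjoint_family_on_def\<close>)
  then show ?thesis by (rule that)
qed

section \<open>Measurability of the marking and of its inverse\<close>

lemma space_purely_atomic_algebra: "space (purely_atomic_algebra S R) = purely_atomic_measures S R"
  by (auto simp: purely_atomic_algebra_def space_restrict_space purely_atomic_measures_def)

lemma measurable_emeasure_purely_atomic:
  "A \<in> sets S \<Longrightarrow> (\<lambda>\<mu>. emeasure \<mu> A) \<in> borel_measurable (purely_atomic_algebra S R)"
  unfolding purely_atomic_algebra_def
  by (intro measurable_restrict_space1 measurable_emeasure_evaluation_algebra)

text \<open>The dissection system does not depend on \<open>\<mu>\<close>, so the cell counts are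
  measurable functions of finitely many evaluations, and they converge pointwise.\<close>

lemma measurable_emeasure_atom_marking_atLeast:
  assumes A: "A \<in> R" and c: "c > 0"
  shows "(\<lambda>\<mu>. emeasure (atom_marking S \<mu>) (A \<times> {c..})) \<in> borel_measurable (purely_atomic_algebra S R)"
proof -
  obtain J D where D: "dissection_system S A J D"
    using dissection_system_exists[OF ring_sets[OF A]] by blast
  note B = atLeast_sets_pos_borel[OF c]
  let ?f = "\<lambda>n \<mu>. \<Sum>j\<in>J n. indicator {c..} (measure \<mu> (D n j)) :: ennreal"
  have f: "?f n \<in> borel_measurable (purely_atomic_algebra S R)" for n
  proof (rule borel_measurable_sum)
    fix j assume "j \<in> J n"
    then have [measurable]: "(\<lambda>\<mu>. emeasure \<mu> (D n j)) \<in> borel_measurable (purely_atomic_algebra S R)"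
      by (intro measurable_emeasure_purely_atomic dissection_systemD(2)[OF D])
    show "(\<lambda>\<mu>. indicator {c..} (measure \<mu> (D n j)) :: ennreal) \<in> borel_measurable (purely_atomic_algebra S R)"
      unfolding measure_def by measurable
  qed
  have "(\<lambda>n. ?f n \<mu>) \<longlonglongrightarrow> emeasure (atom_marking S \<mu>) (A \<times> {c..})"
    if \<mu>: "\<mu> \<in> space (purely_atomic_algebra S R)" for \<mu>
  proof (intro tendsto_eventually eventually_count_cells[OF _ A D B _ _ c])
    fix s
    \<comment> \<open>Masses from \<open>c\<close> on stay in the half-line when increased; a
      smaller mass leaves the gap up to \<open>c\<close> as radius.\<close>
    show "\<exists>r>0. \<forall>x. measure \<mu> {s} \<le> x \<and> x < measure \<mu> {s} + r \<longrightarrow> (x \<in> {c..} \<longleftrightarrow> measure \<mu> {s} \<in> {c..})"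
      by (cases "measure \<mu> {s} \<ge> c") (auto intro: exI[of _ 1] exI[of _ "c - measure \<mu> {s}"])
  qed (use \<mu> space_purely_atomic_algebra in auto)
  then show ?thesis
    by (rule borel_measurable_LIMSEQ_order[OF _ f])
qed

lemma emeasure_atom_marking_box_finite:
  assumes \<mu>: "\<mu> \<in> purely_atomic_measures S R" and "A \<in> R" "c > 0"
  shows "emeasure (atom_marking S \<mu>) (A \<times> {c..}) < \<infinity>"
  using emeasure_atom_marking_eq_card(2)[OF \<mu> \<open>A \<in> R\<close> atLeast_sets_pos_borel order_refl] \<open>c > 0\<close>
  by (simp add: of_nat_less_top)

text \<open>Dynkin's argument in \<open>C\<close>. The box has finite measure under every marking,
  so that complements amount to subtraction.\<close>

lemma measurable_emeasure_atom_marking_box: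
  assumes A: "A \<in> R" and c: "c > 0" and C: "C \<in> sets (S \<Otimes>\<^sub>M pos_borel)"
  shows "(\<lambda>\<mu>. emeasure (atom_marking S \<mu>) (C \<inter> A \<times> {c..})) \<in> borel_measurable (purely_atomic_algebra S R)"
proof -
  let ?\<Omega> = "space S \<times> {0<..}" and ?G = "{A \<times> ({x..} \<inter> {0<..}) |A x. A \<in> sets S} :: ('a \<times> real) set set"
  let ?P = "purely_atomic_algebra S R"
  have box: "A \<times> {c..} \<in> sets (S \<Otimes>\<^sub>M pos_borel)"
    by (intro pair_measureI ring_sets[OF A] atLeast_sets_pos_borel[OF c])
  have box_sub: "A \<times> {c..} \<subseteq> ?\<Omega>"
    using c sets.sets_into_space[OF ring_sets[OF A]] by auto
  have "Int_stable ?G"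
  proof (rule Int_stableI)
    fix X Y assume "X \<in> ?G" "Y \<in> ?G"
    then obtain A1 x1 A2 x2 where XY: "X = A1 \<times> ({x1..} \<inter> {0<..})" "Y = A2 \<times> ({x2..} \<inter> {0<..})"
      "A1 \<in> sets S" "A2 \<in> sets S" by blast
    then have "X \<inter> Y = (A1 \<inter> A2) \<times> ({max x1 x2..} \<inter> {0<..})" by auto
    with XY show "X \<inter> Y \<in> ?G" by blast
  qed
  moreover have "?G \<subseteq> Pow ?\<Omega>" using sets.sets_into_space by fastforce
  moreover have "C \<in> sigma_sets ?\<Omega> ?G" using C by (simp only: sets_prod_pos_borel)
  ultimately show ?thesis
  proof (induction rule: sigma_sets_induct_disjoint)
    case (basic X)
    then obtain A1 x where X: "X = A1 \<times> ({x..} \<inter> {0<..})" "A1 \<in> sets S" by blast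
    \<comment> \<open>A generator cuts the box down to a box of the same kind.\<close>
    have "X \<inter> A \<times> {c..} = (A \<inter> A1) \<times> {max x c..}"
      using c X by auto
    then show ?case
      using c X A by (simp add: measurable_emeasure_atom_marking_atLeast ring_Int)
  next
    case empty
    then show ?case by simp
  next
    case (compl X)
    have X: "X \<in> sets (S \<Otimes>\<^sub>M pos_borel)" using compl(1) by (simp only: sets_prod_pos_borel)
    have "emeasure (atom_marking S \<mu>) ((?\<Omega> - X) \<inter> A \<times> {c..}) =
        emeasure (atom_marking S \<mu>) (A \<times> {c..}) - emeasure (atom_marking S \<mu>) (X \<inter> A \<times> {c..})"
      if "\<mu> \<in> space ?P" for \<mu>
    proof -
      have \<mu>: "\<mu> \<in> purely_atomic_measures S R" using that by (simp add: space_purely_atomic_algebra)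
      have "emeasure (atom_marking S \<mu>) (X \<inter> A \<times> {c..}) \<le> emeasure (atom_marking S \<mu>) (A \<times> {c..})"
        using box by (intro emeasure_mono) auto
      also have "\<dots> < \<infinity>" by (rule emeasure_atom_marking_box_finite[OF \<mu> A c])
      finally have "emeasure (atom_marking S \<mu>) (X \<inter> A \<times> {c..}) \<noteq> \<infinity>" by simp
      then have "emeasure (atom_marking S \<mu>) (A \<times> {c..} - X \<inter> A \<times> {c..}) =
          emeasure (atom_marking S \<mu>) (A \<times> {c..}) - emeasure (atom_marking S \<mu>) (X \<inter> A \<times> {c..})"
        using box X by (intro emeasure_Diff) auto
      moreover have "(?\<Omega> - X) \<inter> A \<times> {c..} = A \<times> {c..} - X \<inter> A \<times> {c..}"
        using box_sub by blast
      ultimately show ?thesis by simp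
    qed
    moreover have "(\<lambda>\<mu>. emeasure (atom_marking S \<mu>) (A \<times> {c..}) -
        emeasure (atom_marking S \<mu>) (X \<inter> A \<times> {c..})) \<in> borel_measurable ?P"
      using compl(2) measurable_emeasure_atom_marking_atLeast[OF A c]
      by (intro borel_measurable_minus_ennreal)
    ultimately show ?case
      by (rule measurable_cong[THEN iffD2])
  next
    case (union X)
    have X: "X i \<inter> A \<times> {c..} \<in> sets (S \<Otimes>\<^sub>M pos_borel)" for i
      using union(2) box by (intro sets.Int) (auto simp: sets_prod_pos_borel)
    have "emeasure (atom_marking S \<mu>) ((\<Union>i. X i) \<inter> A \<times> {c..}) =
        (\<Sum>i. emeasure (atom_marking S \<mu>) (X i \<inter> A \<times> {c..}))" for \<mu>
    proof -
      have "disjoint_family (\<lambda>i. X i \<inter> A \<times> {c..})"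
        using union(1) by (auto simp: disjoint_family_on_def)
      then show ?thesis
        using X by (subst suminf_emeasure) (auto simp: Int_UN_distrib2)
    qed
    then show ?case
      using union(3) by simp
  qed
qed

text \<open>The product space is exhausted by countably many boxes of finite measure; continuity
  from below removes the restriction to a box.\<close>

lemma measurable_atom_marking:
  "atom_marking S \<in> purely_atomic_algebra S R \<rightarrow>\<^sub>M atom_counting_algebra S R"
  unfolding atom_counting_algebra_def
proof (rule measurable_evaluation_algebraI)
  fix \<mu> assume "\<mu> \<in> space (purely_atomic_algebra S R)"
  then show "atom_marking S \<mu> \<in> atom_counting_measures S R"
    by (simp add: space_purely_atomic_algebra atom_marking_counting)
next
  fix C assume C: "C \<in> sets (S \<Otimes>\<^sub>M pos_borel)"
  obtain T :: "nat \<Rightarrow> 'a set" where T: "range T \<subseteq> R" "incseq T" "(\<Union>n. T n) = space S"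
    by (rule exhaustion)
  \<comment> \<open>The lower bounds \<open>1 / Suc n\<close> are positive and tend to 0, while the
    \<open>T n\<close> exhaust \<open>space S\<close>.\<close>
  let ?C = "\<lambda>n. C \<inter> T n \<times> {1 / Suc n..}"
  have C_sets: "?C n \<in> sets (S \<Otimes>\<^sub>M pos_borel)" for n
  proof -
    have "T n \<times> {1 / real (Suc n)..} \<in> sets (S \<Otimes>\<^sub>M pos_borel)"
      using T(1) by (intro pair_measureI ring_sets atLeast_sets_pos_borel) auto
    with C show ?thesis by blast
  qed
  have inc: "incseq ?C"
  proof (rule incseq_SucI)
    fix n
    have "T n \<subseteq> T (Suc n)" using T(2) by (rule incseq_SucD)
    moreover have "1 / real (Suc (Suc n)) \<le> 1 / real (Suc n)" by (simp add: frac_le)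
    ultimately show "?C n \<subseteq> ?C (Suc n)" by fastforce
  qed
  have un: "(\<Union>n. ?C n) = C"
  proof (intro equalityI subsetI)
    fix p assume p: "p \<in> C"
    obtain s x where sx: "p = (s, x)" by (cases p)
    have "s \<in> space S" "x > 0"
      using sets.sets_into_space[OF C] p sx by (auto simp: space_prod_pos_borel)
    then obtain n where n: "s \<in> T n" using T(3) by blast
    obtain m where m: "1 / real (Suc m) < x"
      using reals_Archimedean[OF \<open>x > 0\<close>] by (auto simp: inverse_eq_divide)
    have "s \<in> T (max n m)"
      using n incseqD[OF T(2), of n "max n m"] by auto
    moreover have "1 / real (Suc (max n m)) \<le> 1 / real (Suc m)" by (simp add: frac_le)
    ultimately show "p \<in> (\<Union>n. ?C n)" using p sx m by (intro UN_I[of "max n m"]) auto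
  qed auto
  have "emeasure (atom_marking S \<mu>) C = (SUP n. emeasure (atom_marking S \<mu>) (?C n))" for \<mu>
  proof -
    have "range ?C \<subseteq> sets (atom_marking S \<mu>)"
      by (intro image_subsetI) (simp only: sets_atom_marking C_sets)
    then have "(SUP n. emeasure (atom_marking S \<mu>) (?C n)) = emeasure (atom_marking S \<mu>) (\<Union>n. ?C n)"
      using inc by (rule SUP_emeasure_incseq)
    then show ?thesis by (simp only: un)
  qed
  moreover have "(\<lambda>\<mu>. SUP n. emeasure (atom_marking S \<mu>) (?C n)) \<in> borel_measurable (purely_atomic_algebra S R)"
    using T(1) C by (intro borel_measurable_SUP measurable_emeasure_atom_marking_box) auto
  ultimately show "(\<lambda>\<mu>. emeasure (atom_marking S \<mu>) C) \<in> borel_measurable (purely_atomic_algebra S R)"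
    by simp
qed

text \<open>The inverse sends \<open>N\<close> to the measure whose value at \<open>A\<close> is the
  integral of the second coordinate over \<open>A \<times> {0<..}\<close>, a measurable function of
  \<open>N\<close>.\<close>

lemma measurable_inv_atom_marking:
  "inv_into (purely_atomic_measures S R) (atom_marking S)
    \<in> atom_counting_algebra S R \<rightarrow>\<^sub>M purely_atomic_algebra S R"
proof -
  let ?i = "inv_into (purely_atomic_measures S R) (atom_marking S)"
  have i: "?i N \<in> purely_atomic_measures S R" "atom_marking S (?i N) = N"
    if "N \<in> atom_counting_measures S R" for N
    using that bij_betw_atom_marking by (auto simp: bij_betw_def intro: inv_into_into f_inv_into_f)
  have "?i \<in> atom_counting_algebra S R \<rightarrow>\<^sub>M evaluation_algebra S (locally_finite_measures S R)"
  proof (rule measurable_evaluation_algebraI)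
    fix N assume "N \<in> space (atom_counting_algebra S R)"
    then show "?i N \<in> locally_finite_measures S R"
      using i(1)[of N] by (simp add: atom_counting_algebra_def purely_atomic_measures_def)
  next
    fix A assume A: "A \<in> sets S"
    have "(\<lambda>N. emeasure (?i N) A) \<in> borel_measurable (atom_counting_algebra S R) \<longleftrightarrow>
        (\<lambda>N. \<integral>\<^sup>+p\<in>A \<times> {0<..}. ennreal (snd p) \<partial>N) \<in> borel_measurable (atom_counting_algebra S R)"
    proof (rule measurable_cong)
      fix N assume "N \<in> space (atom_counting_algebra S R)"
      then have "N \<in> atom_counting_measures S R" by (simp add: atom_counting_algebra_def)
      then show "emeasure (?i N) A = (\<integral>\<^sup>+p\<in>A \<times> {0<..}. ennreal (snd p) \<partial>N)"
        using emeasure_eq_integral_atom_marking[OF i(1) A] i(2) by simp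
    qed
    moreover have "(\<lambda>N. \<integral>\<^sup>+p\<in>A \<times> {0<..}. ennreal (snd p) \<partial>N) \<in> borel_measurable (atom_counting_algebra S R)"
      unfolding atom_counting_algebra_def
      by (rule measurable_nn_integral_evaluation_algebra[OF measurable_indicator_times_snd[OF A]])
         (simp add: atom_counting_measures_def)
    ultimately show "(\<lambda>N. emeasure (?i N) A) \<in> borel_measurable (atom_counting_algebra S R)"
      by simp
  qed
  then show ?thesis
    unfolding purely_atomic_algebra_def using i(1)
    by (intro measurable_restrict_space2) (auto simp: atom_counting_algebra_def)
qed

end

theorem lemma2p19:
  fixes S :: "'a measure" and R :: "'a set set"
  assumes "localized_borel_space S R"
  shows "\<exists>N :: 'a measure \<Rightarrow> ('a \<times> real) measure.
    bij_betw N (purely_atomic_measures S R) (atom_counting_measures S R) \<and>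
    N \<in> purely_atomic_algebra S R \<rightarrow>\<^sub>M atom_counting_algebra S R \<and>
    inv_into (purely_atomic_measures S R) N
      \<in> atom_counting_algebra S R \<rightarrow>\<^sub>M purely_atomic_algebra S R \<and>
    (\<forall>\<mu>\<in>purely_atomic_measures S R.
      (\<forall>A\<in>sets S. \<forall>B\<in>sets pos_borel.
        emeasure (N \<mu>) (A \<times> B) = (\<Sum>\<^sub>\<infinity>s\<in>atoms \<mu>. indicator (A \<times> B) (s, measure \<mu> {s}))) \<and>
      (\<forall>A\<in>R. emeasure \<mu> A = (\<integral>\<^sup>+p\<in>A \<times> {0<..}. ennreal (snd p) \<partial>N \<mu>)) \<and>
      (\<forall>A\<in>R. \<forall>B\<in>sets pos_borel. 0 \<notin> closure B \<longrightarrow>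
        (\<forall>J D. dissection_system S A J D \<longrightarrow>
          (open B \<longrightarrow>
            iterated_limit
              (\<lambda>\<epsilon> n. \<Sum>j\<in>J n. indicator (inner_nbhd B \<epsilon>) (measure \<mu> (D n j)))
              (emeasure (N \<mu>) (A \<times> B))) \<and>
          (closed B \<longrightarrow>
            iterated_limit
              (\<lambda>\<epsilon> n. \<Sum>j\<in>J n. indicator (outer_nbhd B \<epsilon>) (measure \<mu> (D n j)))
              (emeasure (N \<mu>) (A \<times> B))))))"
proof -
  interpret localized_space S R
    by standard (rule assms)
  \<comment> \<open>A ball around 0 misses \<open>B\<close>; its radius is a lower bound of
    \<open>B\<close>, whose elements are positive.\<close>
  have below: "\<exists>c>0. B \<subseteq> {c..}" if B: "B \<in> sets pos_borel" "0 \<notin> closure B" for B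
  proof -
    have pos: "B \<subseteq> {0<..}"
      using sets.sets_into_space[OF B(1)] by (simp add: space_restrict_space)
    obtain c where c: "c > 0" "\<And>x. x \<in> B \<Longrightarrow> c \<le> dist x 0"
      using B(2) unfolding closure_approachable by (meson not_le)
    have "B \<subseteq> {c..}"
    proof
      fix x assume "x \<in> B"
      then show "x \<in> {c..}" using c(2)[of x] pos by auto
    qed
    with c show ?thesis by blast
  qed
  show ?thesis
  proof (intro exI[of _ "atom_marking S"] conjI ballI allI impI bij_betw_atom_marking
      measurable_atom_marking measurable_inv_atom_marking)
    fix \<mu> A B assume "\<mu> \<in> purely_atomic_measures S R" "A \<in> sets S" "B \<in> sets pos_borel"
    then show "emeasure (atom_marking S \<mu>) (A \<times> B) =
        (\<Sum>\<^sub>\<infinity>s\<in>atoms \<mu>. indicator (A \<times> B) (s, measure \<mu> {s}))"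
      by (simp add: emeasure_atom_marking infsum_ennreal_eq_nn_integral countable_atoms)
  next
    fix \<mu> A assume "\<mu> \<in> purely_atomic_measures S R" "A \<in> R"
    then show "emeasure \<mu> A = (\<integral>\<^sup>+p\<in>A \<times> {0<..}. ennreal (snd p) \<partial>atom_marking S \<mu>)"
      by (intro emeasure_eq_integral_atom_marking ring_sets)
  next
    fix \<mu> A B J D
    assume *: "\<mu> \<in> purely_atomic_measures S R" "A \<in> R" "B \<in> sets pos_borel" "0 \<notin> closure B"
      "dissection_system S A J D"
    obtain c where c: "c > 0" "B \<subseteq> {c..}"
      using below[OF *(3,4)] by blast
    show "iterated_limit (\<lambda>\<epsilon> n. \<Sum>j\<in>J n. indicator (inner_nbhd B \<epsilon>) (measure \<mu> (D n j)))
        (emeasure (atom_marking S \<mu>) (A \<times> B))" if "open B"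
      by (rule inner_limit_count_cells[OF *(1,2,5,3) c(2,1) that])
    show "iterated_limit (\<lambda>\<epsilon> n. \<Sum>j\<in>J n. indicator (outer_nbhd B \<epsilon>) (measure \<mu> (D n j)))
        (emeasure (atom_marking S \<mu>) (A \<times> B))" if "closed B"
      by (rule outer_limit_count_cells[OF *(1,2,5,3) c(2,1) that])
  qed
qed

end
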